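(* Let $\mathbf{S}^1_{\mathrm{I}},\mathbf{S}^1_{\mathrm{II}}\subset\mathbb{R}^2$ and $\mathbf{S}^1_{\mathrm{III}}\subset\mathbb{R}^3$ be the circles, and $L_{(\mathcal X,\mathcal Z)}$ the Lagrange numbers, defined in the context. (a) There exist a point $\mathbf{n}\in\mathbf{S}^1_{\mathrm{I}}\cap\mathbb{Q}^2$ and a continuous bijection $\Phi^1_{\mathrm{I}}:\mathbb{R}\to\mathbf{S}^1_{\mathrm{I}}\setminus\{\mathbf{n}\}$ which maps $\sqrt2\,\mathbb{Q}$ onto $(\mathbf{S}^1_{\mathrm{I}}\cap\mathbb{Q}^2)\setminus\{\mathbf{n}\}$ and satisfies $$L_{(\mathbb{R},\sqrt2\mathbb{Q})}(\xi)=\sqrt2\,L_{(\mathbf{S}^1_{\mathrm{I}},\,\mathbf{S}^1_{\mathrm{I}}\cap\mathbb{Q}^2)}(\Phi^1_{\mathrm{I}}(\xi))\quad\text{for every }\xi\in\mathbb{R}\setminus\sqrt2\,\mathbb{Q}.$$ (b) There exist a point $\mathbf{n}\in\mathbf{S}^1_{\mathrm{II}}\cap\mathbb{Q}^2$ and a continuous bijection $\Phi^1_{\mathrm{II}}:\mathbb{R}\to\mathbf{S}^1_{\mathrm{II}}\setminus\{\mathbf{n}\}$ which maps $\sqrt2\,\mathbb{Q}$ onto $(\mathbf{S}^1_{\mathrm{II}}\cap\mathbb{Q}^2)\setminus\{\mathbf{n}\}$ and satisfies $$L_{(\mathbb{R},\sqrt2\mathbb{Q})}(\xi)=2\,L_{(\mathbf{S}^1_{\mathrm{II}},\,\mathbf{S}^1_{\mathrm{II}}\cap\mathbb{Q}^2)}(\Phi^1_{\mathrm{II}}(\xi))\quad\text{for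 every }\xi\in\mathbb{R}\setminus\sqrt2\,\mathbb{Q}.$$ (c) There exist a point $\mathbf{n}\in\mathbf{S}^1_{\mathrm{III}}\cap\mathbb{Q}^3$ and a continuous bijection $\Phi^1_{\mathrm{III}}:\mathbb{R}\to\mathbf{S}^1_{\mathrm{III}}\setminus\{\mathbf{n}\}$ which maps $\mathbb{Q}$ onto $(\mathbf{S}^1_{\mathrm{III}}\cap\mathbb{Q}^3)\setminus\{\mathbf{n}\}$ and satisfies $$L_{(\mathbb{R},\mathbb{Q})}(\xi)=\sqrt2\,L_{(\mathbf{S}^1_{\mathrm{III}},\,\mathbf{S}^1_{\mathrm{III}}\cap\mathbb{Q}^3)}(\Phi^1_{\mathrm{III}}(\xi))\quad\text{for every }\xi\in\mathbb{R}\setminus\mathbb{Q}.$$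
   Context: Lagrange numbers. Let $(\mathcal X,\mathrm d)$ be a complete metric space, $\mathcal Z\subset\mathcal X$ a countable dense subset, and $\mathrm{Ht}_{\mathcal Z}:\mathcal Z\to\mathbb{R}_{\ge0}$ a height function. For $P\in\mathcal X\setminus\mathcal Z$, $$L_{(\mathcal X,\mathcal Z)}(P)=\limsup_{Z\in\mathcal Z}\frac{1}{\mathrm{Ht}_{\mathcal Z}(Z)\,\mathrm d(P,Z)}\in[0,\infty],$$ where the limsup over the countable set $\mathcal Z$ is $\inf_{F\subset\mathcal Z\text{ finite}}\ \sup_{Z\in\mathcal Z\setminus F}$ (equivalently, the supremum of those $L\ge 0$ for which $\mathrm d(P,Z)<1/(L\,\mathrm{Ht}_{\mathcal Z}(Z))$ has infinitely many solutions $Z\in\mathcal Z$). Circles. $\mathbf{S}^1_{\mathrm{I}}=\{(x_1,x_2)\in\mathbb{R}^2: x_1^2+x_2^2=1\}$; $\mathbf{S}^1_{\mathrm{II}}=\{(x_1,x_2)\in\mathbb{R}^2: x_1^2+x_2^2=2\}$; $\mathbf{S}^1_{\mathrm{III}}=\{(x_0,x_1,x_2)\in\mathbb{R}^3: x_0+x_1+x_2=1,\ x_0^2+x_1^2+x_2^2=1\}$. The distance on each is the Euclidean distance of the ambient $\mathbb{R}^l$ ($l=2,2,3$). The height of a rational point is $\mathrm{Ht}(\mathbf p/q)=|q|$, where $\mathbf p\in\mathbb{Z}^l$ is primitive (its coordinates have no common divisor $>1$) and $q$ is a nonzero integer (on these circles this is equivalent to requiring that the coordinates of $\mathbf p$ together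 with $q$ have gcd $1$). Real line. The distance on $\mathbb{R}$ is $|x-y|$. On $\mathbb{Q}$: $\mathrm{Ht}_{\mathbb{Q}}(p/q)=q^2$ for a reduced fraction $p/q$. On $\sqrt2\,\mathbb{Q}=\{\sqrt2 t: t\in\mathbb{Q}\}$: every $r\in\sqrt2\,\mathbb{Q}$ can be written uniquely up to signs with coprime integers $p,q$ either as $r=\sqrt2\,p/q$ with $q$ odd, or as $r=p/(\sqrt2\,q)$ with $p$ odd; set $\mathrm{Ht}_{\sqrt2\mathbb{Q}}(r)=q^2$ in the first case and $\mathrm{Ht}_{\sqrt2\mathbb{Q}}(r)=2q^2$ in the second. *)

theory Defs
  imports "HOL-Analysis.Analysis"
begin

text \<open>
  The limsup over the index set \<open>Z\<close> is the infimum over the finite subsets \<open>F\<close> of \<open>Z\<close> of the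
  supremum over \<open>Z - F\<close>. Values lie in \<open>[0, \<infinity>]\<close>; division in \<^typ>\<open>ennreal\<close>
  gives \<open>1 / 0 = \<infinity>\<close>. The ambient space \<open>X\<close> is not a parameter: it enters only through
  its distance, which for subsets of a Euclidean space is the restriction of \<^const>\<open>dist\<close>.
  The definition is meant for \<open>P\<close> in \<open>X - Z\<close>.
\<close>

definition lagrange_number :: "'a::metric_space set \<Rightarrow> ('a \<Rightarrow> real) \<Rightarrow> 'a \<Rightarrow> ennreal" where
  "lagrange_number Z Ht P =
     (INF F\<in>{F. finite F \<and> F \<subseteq> Z}. SUP z\<in>Z - F. 1 / ennreal (Ht z * dist P z))"

definition circle_I :: "(real^2) set" where
  "circle_I = {x. (x$1)\<^sup>2 + (x$2)\<^sup>2 = 1}"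

definition circle_II :: "(real^2) set" where
  "circle_II = {x. (x$1)\<^sup>2 + (x$2)\<^sup>2 = 2}"

text \<open>The coordinates \<open>x\<^sub>0, x\<^sub>1, x\<^sub>2\<close> are indexed here by \<open>1, 2, 3\<close>.\<close>

definition circle_III :: "(real^3) set" where
  "circle_III = {x. x$1 + x$2 + x$3 = 1 \<and> (x$1)\<^sup>2 + (x$2)\<^sup>2 + (x$3)\<^sup>2 = 1}"

definition rational_points :: "(real^'n) set" where
  "rational_points = {x. \<forall>i. x$i \<in> \<rat>}"

definition primitive_vec :: "int^'n \<Rightarrow> bool" where
  "primitive_vec p \<longleftrightarrow> Gcd (range (\<lambda>i. p$i)) = 1"

text \<open>
  The value is uniquely determined whenever a representation \<open>p / q\<close> with \<open>p\<close> primitive exists.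
  This is the case for every rational point of the three circles, but not for all rational
  points of the ambient space.
\<close>

definition height_vec :: "real^'n \<Rightarrow> real" where
  "height_vec x = (THE h. \<exists>(p::int^'n) (q::int). primitive_vec p \<and> q \<noteq> 0 \<and>
     x = (\<chi> i. of_int (p$i) / of_int q) \<and> h = \<bar>of_int q\<bar>)"

definition height_Q :: "real \<Rightarrow> real" where
  "height_Q r = (THE h. \<exists>p q :: int. coprime p q \<and> q \<noteq> 0 \<and>
     r = of_int p / of_int q \<and> h = (of_int q)\<^sup>2)"

definition sqrt2_Q :: "real set" where
  "sqrt2_Q = {sqrt 2 * t | t. t \<in> \<rat>}"

definition height_sqrt2_Q :: "real \<Rightarrow> real" where
  "height_sqrt2_Q r = (THE h. \<exists>p q :: int. coprime p q \<and> q \<noteq> 0 \<and>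
     (odd q \<and> r = sqrt 2 * of_int p / of_int q \<and> h = (of_int q)\<^sup>2 \<or>
      odd p \<and> r = of_int p / (sqrt 2 * of_int q) \<and> h = 2 * (of_int q)\<^sup>2))"

end

theory Submission
  imports Defs
begin

text \<open>
  All three maps are inverse stereographic projections from a rational point. For such a map
  \<open>\<Phi>\<close> there are a positive continuous function \<open>g\<close> and a constant \<open>K\<close> with
  \<open>dist (\<Phi> s) (\<Phi> t) = K * \<bar>s - t\<bar> / (g s * g t)\<close>, while the height of \<open>\<Phi> z\<close> is
  \<open>\<kappa> * (g z)\<^sup>2\<close> times the height of \<open>z\<close>. Hence height times distance is multiplied by
  \<open>\<kappa> * K * g z / g \<xi>\<close>, which tends to \<open>\<kappa> * K\<close> as \<open>z\<close> tends to \<open>\<xi>\<close>; the pole and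
  the points that stay away from \<open>\<xi>\<close> do not affect the limsup.
\<close>

subsection \<open>Comparing Lagrange numbers\<close>

text \<open>The sets \<open>Z - F\<close> with \<open>F\<close> finite form a basis of this filter.
  The filter form gives access to eventual estimates and to the transport of a limsup along an
  injective map.\<close>

lemma lagrange_number_eq_Limsup:
  "lagrange_number Z H P = Limsup (inf cofinite (principal Z)) (\<lambda>z. 1 / ennreal (H z * dist P z))"
proof -
  have ev: "eventually Q (inf cofinite (principal Z)) \<longleftrightarrow> finite {z \<in> Z. \<not> Q z}" for Q
    by (simp add: eventually_inf_principal eventually_cofinite)
  show ?thesis
    unfolding lagrange_number_def Limsup_def
  proof (rule antisym; rule INF_mono; clarify)
    fix Q assume "eventually Q (inf cofinite (principal Z))"
    then have "finite {z \<in> Z. \<not> Q z}" by (simp add: ev)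
    then show "\<exists>F\<in>{F. finite F \<and> F \<subseteq> Z}. (SUP z\<in>Z - F. 1 / ennreal (H z * dist P z))
                 \<le> (SUP z\<in>Collect Q. 1 / ennreal (H z * dist P z))"
      by (intro bexI[of _ "{z \<in> Z. \<not> Q z}"] SUP_subset_mono) auto
  next
    fix F assume F: "finite F" "F \<subseteq> Z"
    then have "eventually (\<lambda>z. z \<in> Z - F) (inf cofinite (principal Z))"
      by (auto simp: ev elim: rev_finite_subset)
    then show "\<exists>Q\<in>{Q. eventually Q (inf cofinite (principal Z))}.
        (SUP z\<in>Collect Q. 1 / ennreal (H z * dist P z)) \<le> (SUP z\<in>Z - F. 1 / ennreal (H z * dist P z))"
      by (intro bexI[of _ "\<lambda>z. z \<in> Z - F"] SUP_subset_mono) auto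
  qed
qed

text \<open>If 1 / b has finite limsup l, then eventually 1 / b < l + e. The first alternative then
  gives 1 / a \<le> c (1 + e) (l + e), the second 1 / a \<le> e, and for small e both lie below any
  given bound above c l. The second alternative serves points far from the target, where
  \<open>a\<close> is large but its ratio to \<open>b\<close> is not close to the limiting
  one.\<close>

lemma Limsup_inverse_le:
  fixes a b :: "'a \<Rightarrow> real"
  assumes c: "c > 0" and pos: "eventually (\<lambda>x. a x > 0 \<and> b x > 0) F"
    and le: "\<And>e. e > 0 \<Longrightarrow> eventually (\<lambda>x. b x \<le> c * (1 + e) * a x \<or> a x \<ge> 1 / e) F"
  shows "Limsup F (\<lambda>x. 1 / ennreal (a x)) \<le> ennreal c * Limsup F (\<lambda>x. 1 / ennreal (b x))"
proof (cases "Limsup F (\<lambda>x. 1 / ennreal (b x))")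
  case top
  then show ?thesis using c by (simp add: ennreal_mult_top)
next
  case (real l)
  show ?thesis unfolding Limsup_le_iff
  proof (intro allI impI)
    fix y assume y: "y > ennreal c * Limsup F (\<lambda>x. 1 / ennreal (b x))"
    show "eventually (\<lambda>x. 1 / ennreal (a x) < y) F"
    proof (cases y)
      case top
      \<comment> \<open>Eventual positivity of \<open>a\<close> makes the quotient finite, hence
        strictly below infinity.\<close>
      show ?thesis using pos by eventually_elim (simp add: top flip: ennreal_1 add: divide_ennreal)
    next
      case (real r)
      have lt: "c * l < r"
        using y c \<open>0 \<le> l\<close> by (simp add: real \<open>_ = ennreal l\<close> flip: ennreal_mult)
          (metis ennreal_less_iff mult_nonneg_nonneg less_imp_le)
      \<comment> \<open>The error e is chosen so small that the bounds from both alternatives stay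
        below \<open>r\<close>; this is possible since \<open>r\<close> exceeds both c l and
        0.\<close>
      have "((\<lambda>e. c * (1 + e) * (l + e)) \<longlongrightarrow> c * (1 + 0) * (l + 0)) (at_right (0::real))"
        by (intro tendsto_intros)
      then have "eventually (\<lambda>e. c * (1 + e) * (l + e) < r) (at_right 0)"
        using lt by (auto dest: order_tendstoD(2))
      moreover have "eventually (\<lambda>e. e < r) (at_right (0::real))"
        using lt c \<open>0 \<le> l\<close> by (intro order_tendstoD(2)[of _ 0] tendsto_intros)
          (smt (verit) mult_nonneg_nonneg)
      ultimately have "eventually (\<lambda>e. 0 < e \<and> c * (1 + e) * (l + e) < r \<and> e < r) (at_right 0)"
        using eventually_at_right_less[of "0::real"] by (simp add: eventually_conj_iff)
      then obtain e where e: "e > 0" "c * (1 + e) * (l + e) < r" "e < r"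
        using eventually_happens'[OF trivial_limit_at_right_real] by blast
      have "eventually (\<lambda>x. 1 / ennreal (b x) < ennreal (l + e)) F"
        using e(1) \<open>0 \<le> l\<close> by (intro Limsup_lessD) (simp add: \<open>_ = ennreal l\<close> ennreal_less_iff)
      then show ?thesis using pos le[OF e(1)]
      proof eventually_elim
        case (elim x)
        then have b: "1 / b x < l + e"
          using e(1) \<open>0 \<le> l\<close> by (simp flip: ennreal_1 add: divide_ennreal ennreal_less_iff del: ennreal_plus)
        have "1 / a x < r" using elim(3)
        proof
          assume "b x \<le> c * (1 + e) * a x"
          then have "1 / a x \<le> c * (1 + e) * (1 / b x)"
            using elim(2) by (simp add: field_simps)
          also have "\<dots> \<le> c * (1 + e) * (l + e)"
            using b c e(1) by (intro mult_left_mono) auto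
          finally show ?thesis using e(2) by simp
        next
          assume "1 / e \<le> a x"
          then have "1 / a x \<le> e" using elim(2) e(1) by (simp add: field_simps)
          then show ?thesis using e(3) by simp
        qed
        then show ?case
          using elim(2) by (simp flip: ennreal_1 add: divide_ennreal real ennreal_less_iff)
      qed
    qed
  qed
qed

text \<open>The two conditions in \<open>H\<close> express discreteness: away from
  \<open>\<xi>\<close>, height times distance exceeds any bound up to finitely many points. The
  lower bound \<open>m\<close> on \<open>g\<close> carries this growth over to \<open>W\<close>,
  since it keeps \<open>g z / g \<xi>\<close> away from 0 even for distant \<open>z\<close>.\<close>

lemma lagrange_number_transfer:
  fixes \<Phi> :: "real \<Rightarrow> 'a::metric_space" and g :: "real \<Rightarrow> real"
  assumes dist: "\<And>s t. dist (\<Phi> s) (\<Phi> t) = K * \<bar>s - t\<bar> / (g s * g t)"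
    and Ht: "\<And>z. z \<in> Z \<Longrightarrow> H' (\<Phi> z) = \<kappa> * (g z)\<^sup>2 * H z"
    and "K > 0" "\<kappa> > 0" "m > 0"
    and g: "\<And>x. g x \<ge> m" "continuous_on UNIV g"
    and H: "\<And>z. z \<in> Z \<Longrightarrow> H z \<ge> 1" "\<And>B. finite {z \<in> Z. H z \<le> B \<and> \<bar>z\<bar> \<le> B}"
    and img: "\<Phi> ` Z = W - {n}" and \<xi>: "\<xi> \<notin> Z"
  shows "lagrange_number Z H \<xi> = ennreal (\<kappa> * K) * lagrange_number W H' (\<Phi> \<xi>)"
proof -
  define F where "F = inf cofinite (principal Z)"
  define a where "a z = H z * dist \<xi> z" for z
  define b where "b z = H' (\<Phi> z) * dist (\<Phi> \<xi>) (\<Phi> z)" for z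
  have gpos: "g x > 0" for x using g(1)[of x] \<open>m > 0\<close> by linarith
  have inj: "inj \<Phi>"
  proof (rule injI)
    fix s t assume "\<Phi> s = \<Phi> t"
    then show "s = t" using dist[of s t] \<open>K > 0\<close> gpos[of s] gpos[of t] by auto
  qed
  \<comment> \<open>A set of exceptions in \<open>W\<close> and its preimage in \<open>Z\<close>
    differ, up to the injection \<open>\<Phi>\<close>, by at most the point \<open>n\<close>, so one
    is finite iff the other is.\<close>
  have map: "filtermap \<Phi> F = inf cofinite (principal W)"
  proof (rule filter_eqI)
    fix Q
    have "{w \<in> W. \<not> Q w} - {n} = {w \<in> W - {n}. \<not> Q w}" by auto
    also have "\<dots> = \<Phi> ` {z \<in> Z. \<not> Q (\<Phi> z)}" unfolding img[symmetric] by auto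
    finally have "finite ({w \<in> W. \<not> Q w} - {n}) \<longleftrightarrow> finite {z \<in> Z. \<not> Q (\<Phi> z)}"
      using inj by (simp add: finite_image_iff inj_on_subset)
    then show "eventually Q (filtermap \<Phi> F) \<longleftrightarrow> eventually Q (inf cofinite (principal W))"
      by (simp add: F_def eventually_filtermap eventually_inf_principal eventually_cofinite)
  qed
  have L': "lagrange_number W H' (\<Phi> \<xi>) = Limsup F (\<lambda>z. 1 / ennreal (b z))"
    unfolding lagrange_number_eq_Limsup b_def map[symmetric] by (rule Limsup_filtermap_eq[OF inj])
  have L: "lagrange_number Z H \<xi> = Limsup F (\<lambda>z. 1 / ennreal (a z))"
    unfolding lagrange_number_eq_Limsup a_def F_def ..
  have FZ: "eventually (\<lambda>z. z \<in> Z) F"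
    by (simp add: F_def eventually_inf_principal)
  have apos: "a z > 0" if "z \<in> Z" for z
    using H(1)[OF that] \<xi> that by (auto simp: a_def intro!: mult_pos_pos)
  have b_eq: "b z = \<kappa> * K * (g z / g \<xi>) * a z" if "z \<in> Z" for z
    using Ht[OF that] gpos[of z] gpos[of \<xi>]
    by (simp add: a_def b_def dist dist_real_def field_simps power2_eq_square)
  have bpos: "b z > 0" if "z \<in> Z" for z
    using apos[OF that] gpos[of z] gpos[of \<xi>] \<open>K > 0\<close> \<open>\<kappa> > 0\<close> by (simp add: b_eq that)
  have pos: "eventually (\<lambda>z. a z > 0 \<and> b z > 0) F"
    using FZ by eventually_elim (simp add: apos bpos)
  \<comment> \<open>Points at distance at least \<open>d\<close> from \<open>\<xi>\<close> contribute nothing: for all but finitely many of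
      them \<open>a\<close> is large.\<close>
  have far: "eventually (\<lambda>z. \<bar>z - \<xi>\<bar> \<ge> d \<longrightarrow> a z \<ge> M) F" if "d > 0" for d M
  proof -
    \<comment> \<open>For an exceptional \<open>z\<close>, distance at least \<open>d\<close> gives
      H z \<le> |M| / d, and height at least 1 gives |z - \<xi>| < M. The sum is a single bound
      valid for both height and size, as the finiteness hypothesis asks.\<close>
    have "{z \<in> Z. \<not> (\<bar>z - \<xi>\<bar> \<ge> d \<longrightarrow> a z \<ge> M)} \<subseteq>
        {z \<in> Z. H z \<le> \<bar>M\<bar> / d + \<bar>M\<bar> + \<bar>\<xi>\<bar> \<and> \<bar>z\<bar> \<le> \<bar>M\<bar> / d + \<bar>M\<bar> + \<bar>\<xi>\<bar>}"
    proof safe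
      fix z assume z: "z \<in> Z" "d \<le> \<bar>z - \<xi>\<bar>" "\<not> a z \<ge> M"
      have a: "H z * \<bar>z - \<xi>\<bar> < M" using z(3) by (simp add: a_def dist_real_def abs_minus_commute)
      have "H z * d \<le> H z * \<bar>z - \<xi>\<bar>" using H(1)[OF z(1)] z(2) by (intro mult_left_mono) auto
      then have "H z \<le> \<bar>M\<bar> / d" using a \<open>d > 0\<close> by (simp add: field_simps)
      then show "H z \<le> \<bar>M\<bar> / d + \<bar>M\<bar> + \<bar>\<xi>\<bar>" by simp
      have "\<bar>z - \<xi>\<bar> \<le> H z * \<bar>z - \<xi>\<bar>" using H(1)[OF z(1)] by (simp add: mult_le_cancel_right1)
      then have "\<bar>z\<bar> \<le> \<bar>M\<bar> + \<bar>\<xi>\<bar>" using a by simp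
      moreover have "\<bar>M\<bar> / d \<ge> 0" using \<open>d > 0\<close> by simp
      ultimately show "\<bar>z\<bar> \<le> \<bar>M\<bar> / d + \<bar>M\<bar> + \<bar>\<xi>\<bar>" by linarith
    qed
    from finite_subset[OF this H(2)] show ?thesis
      by (simp add: F_def eventually_inf_principal eventually_cofinite Collect_conj_eq)
  qed
  \<comment> \<open>Formulated for an arbitrary open property so that the upper and the lower
    estimate of the ratio both follow.\<close>
  have near: "\<exists>d>0. \<forall>z. \<bar>z - \<xi>\<bar> < d \<longrightarrow> Q (g z / g \<xi>)" if "open (Collect Q)" "Q 1" for Q
  proof -
    have "isCont (\<lambda>z. g z / g \<xi>) \<xi>"
      using g(2) gpos[of \<xi>] by (intro continuous_intros) (auto simp: continuous_on_eq_continuous_at)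
    then have "((\<lambda>z. g z / g \<xi>) \<longlongrightarrow> g \<xi> / g \<xi>) (nhds \<xi>)"
      using tendsto_at_iff_tendsto_nhds[of "\<lambda>z. g z / g \<xi>" \<xi>] by (simp only: isCont_def)
    moreover have "g \<xi> / g \<xi> = 1" using gpos[of \<xi>] by simp
    ultimately have "eventually (\<lambda>z. g z / g \<xi> \<in> Collect Q) (nhds \<xi>)"
      using that topological_tendstoD by fastforce
    then show ?thesis by (auto simp: eventually_nhds_metric dist_real_def)
  qed
  have le1: "Limsup F (\<lambda>z. 1 / ennreal (a z)) \<le> ennreal (\<kappa> * K) * Limsup F (\<lambda>z. 1 / ennreal (b z))"
  proof (rule Limsup_inverse_le[OF _ pos])
    fix e :: real assume "e > 0"
    obtain d where d: "d > 0" "\<And>z. \<bar>z - \<xi>\<bar> < d \<Longrightarrow> g z / g \<xi> < 1 + e"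
      using near[of "\<lambda>x. x < 1 + e"] \<open>e > 0\<close> by (auto simp: open_Collect_less)
    show "eventually (\<lambda>z. b z \<le> \<kappa> * K * (1 + e) * a z \<or> 1 / e \<le> a z) F"
      using far[OF d(1), of "1 / e"] FZ
    proof eventually_elim
      case (elim z)
      show ?case
      proof (cases "\<bar>z - \<xi>\<bar> < d")
        case True
        then have "\<kappa> * K * (g z / g \<xi>) * a z \<le> \<kappa> * K * (1 + e) * a z"
          using d(2) \<open>K > 0\<close> \<open>\<kappa> > 0\<close> apos[OF elim(2)]
          by (intro mult_right_mono mult_left_mono) (auto intro: less_imp_le)
        then show ?thesis using elim by (simp add: b_eq)
      qed (use elim in auto)
    qed
  qed (use \<open>K > 0\<close> \<open>\<kappa> > 0\<close> in simp)
  have le2: "Limsup F (\<lambda>z. 1 / ennreal (b z)) \<le> ennreal (1 / (\<kappa> * K)) * Limsup F (\<lambda>z. 1 / ennreal (a z))"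
  proof (rule Limsup_inverse_le)
    fix e :: real assume "e > 0"
    obtain d where d: "d > 0" "\<And>z. \<bar>z - \<xi>\<bar> < d \<Longrightarrow> g z / g \<xi> > 1 / (1 + e)"
      using near[of "\<lambda>x. x > 1 / (1 + e)"] \<open>e > 0\<close> by (auto simp: open_Collect_less)
    \<comment> \<open>This \<open>c\<close> bounds b / a from below on all of \<open>Z\<close>,
      because \<open>g z\<close> is at least \<open>m\<close>. Far from \<open>\<xi>\<close>, a
      \<ge> 1 / (e c) therefore forces b \<ge> 1 / e.\<close>
    define c where "c = \<kappa> * K * (m / g \<xi>)"
    have c: "c > 0" using \<open>K > 0\<close> \<open>\<kappa> > 0\<close> \<open>m > 0\<close> gpos by (simp add: c_def)
    show "eventually (\<lambda>z. a z \<le> 1 / (\<kappa> * K) * (1 + e) * b z \<or> 1 / e \<le> b z) F"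
      using far[OF d(1), of "1 / e / c"] FZ
    proof eventually_elim
      case (elim z)
      show ?case
      proof (cases "\<bar>z - \<xi>\<bar> < d")
        case True
        then have "1 \<le> (1 + e) * (g z / g \<xi>)" using d(2)[OF True] \<open>e > 0\<close> by (simp add: field_simps)
        then have "1 * a z \<le> (1 + e) * (g z / g \<xi>) * a z"
          using apos[OF elim(2)] by (intro mult_right_mono) auto
        also have "\<dots> = 1 / (\<kappa> * K) * (1 + e) * b z"
          using \<open>K > 0\<close> \<open>\<kappa> > 0\<close> by (simp add: b_eq elim)
        finally show ?thesis by simp
      next
        case False
        then have "c * (1 / e / c) \<le> c * a z" using elim c by (intro mult_left_mono) auto
        then have "1 / e \<le> c * a z" using c by simp
        also have "\<dots> \<le> b z"
          unfolding b_eq[OF elim(2)] c_def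
          using \<open>K > 0\<close> \<open>\<kappa> > 0\<close> apos[OF elim(2)] g(1)[of z] gpos[of \<xi>]
          by (intro mult_right_mono mult_left_mono divide_right_mono) auto
        finally show ?thesis by simp
      qed
    qed
  qed (use \<open>K > 0\<close> \<open>\<kappa> > 0\<close> pos in \<open>auto elim: eventually_mono\<close>)
  \<comment> \<open>Multiplying \<open>le2\<close> by the finite nonzero constant \<kappa> K turns
    it into the converse of \<open>le1\<close>.\<close>
  have "ennreal (\<kappa> * K) * Limsup F (\<lambda>z. 1 / ennreal (b z)) \<le>
      ennreal (\<kappa> * K) * (ennreal (1 / (\<kappa> * K)) * Limsup F (\<lambda>z. 1 / ennreal (a z)))"
    using le2 by (intro mult_left_mono) auto
  also have "\<dots> = Limsup F (\<lambda>z. 1 / ennreal (a z))"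
    using \<open>K > 0\<close> \<open>\<kappa> > 0\<close> by (simp add: mult.assoc[symmetric] flip: ennreal_mult)
  finally show ?thesis using le1 unfolding L L' by (rule antisym[rotated])
qed

text \<open>Reduces the claims about images of rational points to a pointwise rationality criterion
  for the parametrization.\<close>

lemma image_eq_of_bij_betw:
  assumes "bij_betw f UNIV (C - {n})" "\<And>x. f x \<in> R \<longleftrightarrow> x \<in> Z"
  shows "f ` Z = C \<inter> R - {n}"
proof -
  have "range f = C - {n}" using assms(1) by (simp add: bij_betw_def)
  moreover have "f ` Z = range f \<inter> R" using assms(2) by blast
  ultimately show ?thesis by blast
qed

section \<open>Coordinate distances and continuity from the chordal formula\<close>

lemma dist_vec2: "dist x y = sqrt ((x$1 - y$1)\<^sup>2 + (x$2 - y$2)\<^sup>2)" for x y :: "real^2"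
  by (simp add: dist_vec_def L2_set_def sum_2 dist_real_def)

lemma dist_vec3:
  "dist x y = sqrt ((x$1 - y$1)\<^sup>2 + (x$2 - y$2)\<^sup>2 + (x$3 - y$3)\<^sup>2)" for x y :: "real^3"
  by (simp add: dist_vec_def L2_set_def sum_3 dist_real_def)

text \<open>The lower bound on \<open>g\<close> turns the chordal formula into a Lipschitz estimate
  with constant \<open>K / m\<^sup>2\<close>.\<close>

lemma continuous_on_chordal:
  fixes \<Phi> :: "real \<Rightarrow> 'a::metric_space"
  assumes dist: "\<And>s t. dist (\<Phi> s) (\<Phi> t) = K * \<bar>s - t\<bar> / (g s * g t)"
    and g: "\<And>x. g x \<ge> m" and "m > 0" "K > 0"
  shows "continuous_on UNIV \<Phi>"
proof (rule lipschitz_on_continuous_on)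
  show "(K / m\<^sup>2)-lipschitz_on UNIV \<Phi>"
  proof (rule lipschitz_onI)
    fix s t
    have "m\<^sup>2 \<le> g s * g t"
      using g[of s] g[of t] \<open>m > 0\<close> by (simp add: power2_eq_square mult_mono)
    then show "dist (\<Phi> s) (\<Phi> t) \<le> K / m\<^sup>2 * dist s t"
      using \<open>m > 0\<close> \<open>K > 0\<close> by (simp add: dist dist_real_def frac_le)
  qed (use \<open>K > 0\<close> in simp)
qed

subsection \<open>Heights\<close>

lemma coprime_fraction_unique:
  fixes a b c d :: int
  assumes "coprime a b" "coprime c d" "b \<noteq> 0" "d \<noteq> 0"
    and eq: "(of_int a / of_int b :: real) = of_int c / of_int d"
  shows "\<bar>a\<bar> = \<bar>c\<bar> \<and> \<bar>b\<bar> = \<bar>d\<bar>"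
proof -
  have "real_of_int (a * d) = of_int (c * b)" using assms by (simp add: field_simps)
  then have "a * d = c * b" by (simp only: of_int_eq_iff)
  then have "\<bar>a\<bar> * \<bar>d\<bar> = \<bar>c\<bar> * \<bar>b\<bar>" by (metis abs_mult)
  then show ?thesis using coprime_crossproduct_int[OF assms(1,2)] by (simp add: mult.commute)
qed

text \<open>Two representations p / q = p' / q' satisfy q' p_i = q p'_i for all i. Taking the gcd
  over i, with both vectors primitive, leaves |q'| = |q|.\<close>

lemma height_vec_eq:
  fixes p :: "int^'n"
  assumes "primitive_vec p" "q \<noteq> 0"
  shows "height_vec (\<chi> i. of_int (p$i) / of_int q) = \<bar>of_int q\<bar>"
  unfolding height_vec_def
proof (rule the_equality)
  fix h :: real assume "\<exists>(p'::int^'n) (q'::int). primitive_vec p' \<and> q' \<noteq> 0 \<and>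
     (\<chi> i. real_of_int (p$i) / of_int q) = (\<chi> i. of_int (p'$i) / of_int q') \<and> h = \<bar>of_int q'\<bar>"
  then obtain p' :: "int^'n" and q' where p': "primitive_vec p'" "q' \<noteq> 0" "h = \<bar>of_int q'\<bar>"
    and eq: "\<And>i. real_of_int (p$i) / of_int q = of_int (p'$i) / of_int q'"
    by (auto simp: vec_eq_iff)
  have "q' * p$i = q * p'$i" for i
  proof -
    have "real_of_int (q' * p$i) = of_int (q * p'$i)"
      using eq[of i] p' assms(2) by (simp add: field_simps)
    then show ?thesis by (simp only: of_int_eq_iff)
  qed
  then have "(*) q' ` range (\<lambda>i. p$i) = (*) q ` range (\<lambda>i. p'$i)"
    by (simp add: image_image)
  then have "normalize (q' * Gcd (range (\<lambda>i. p$i))) = normalize (q * Gcd (range (\<lambda>i. p'$i)))"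
    by (metis Gcd_mult)
  then have "\<bar>q'\<bar> = \<bar>q\<bar>"
    using assms(1) p' by (simp add: primitive_vec_def)
  then show "h = \<bar>of_int q\<bar>"
    using p'(3) by (metis of_int_abs)
qed (rule exI[of _ p], rule exI[of _ q], use assms in simp)

lemma primitive_vec2: "primitive_vec (vector [a, b] :: int^2) \<longleftrightarrow> coprime a b"
proof -
  have "range (\<lambda>i. (vector [a, b] :: int^2) $ i) = {a, b}" by (auto simp: UNIV_2)
  then show ?thesis by (simp add: primitive_vec_def coprime_iff_gcd_eq_1)
qed

lemma primitive_vec3: "primitive_vec (vector [a, b, c] :: int^3) \<longleftrightarrow> gcd a (gcd b c) = 1"
proof -
  have "range (\<lambda>i. (vector [a, b, c] :: int^3) $ i) = {a, b, c}" by (auto simp: UNIV_3)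
  then show ?thesis by (simp add: primitive_vec_def)
qed

lemma height_Q_eq:
  fixes p q :: int
  assumes "coprime p q" "q \<noteq> 0"
  shows "height_Q (of_int p / of_int q) = (of_int q)\<^sup>2"
  unfolding height_Q_def
proof (rule the_equality)
  fix h :: real assume "\<exists>p' q'. coprime p' q' \<and> q' \<noteq> 0 \<and>
    (of_int p / of_int q :: real) = of_int p' / of_int q' \<and> h = (of_int q')\<^sup>2"
  then obtain p' q' where *: "coprime p' q'" "q' \<noteq> 0" "h = (of_int q')\<^sup>2"
    "(of_int p / of_int q :: real) = of_int p' / of_int q'"
    by blast
  from coprime_fraction_unique[OF assms(1) *(1) assms(2) *(2,4)]
  have "\<bar>real_of_int q\<bar> = \<bar>of_int q'\<bar>" by (simp flip: of_int_abs)
  then show "h = (of_int q)\<^sup>2" using *(3) by (metis power2_abs)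
qed (rule exI[of _ p], rule exI[of _ q], use assms in simp)

text \<open>Both shapes in the definition merge once \<open>sqrt 2 * r\<close> is written as a
  reduced fraction m / n: even \<open>m\<close> is the first shape with p = m / 2, odd
  \<open>m\<close> the second. Uniqueness of reduced fractions then fixes the height.\<close>

lemma height_sqrt2_Q_eq:
  fixes m n :: int
  assumes mn: "coprime m n" "n \<noteq> 0"
  shows "height_sqrt2_Q (of_int m / (sqrt 2 * of_int n)) = (if even m then 1 else 2) * (of_int n)\<^sup>2"
  unfolding height_sqrt2_Q_def
proof (rule the_equality)
  show "\<exists>p q :: int. coprime p q \<and> q \<noteq> 0 \<and>
     (odd q \<and> of_int m / (sqrt 2 * of_int n) = sqrt 2 * of_int p / of_int q \<and>
        (if even m then 1 else 2) * (of_int n)\<^sup>2 = ((of_int q)\<^sup>2 :: real) \<or>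
      odd p \<and> of_int m / (sqrt 2 * of_int n) = of_int p / (sqrt 2 * of_int q) \<and>
        (if even m then 1 else 2) * (of_int n)\<^sup>2 = (2 * (of_int q)\<^sup>2 :: real))"
  proof (cases "even m")
    case True
    then obtain p where m: "m = 2 * p" by blast
    have "odd n" "coprime p n" using mn m by auto
    moreover have "of_int m / (sqrt 2 * of_int n) = sqrt 2 * of_int p / of_int n"
      using mn m by (simp add: field_simps)
    ultimately show ?thesis using True mn by auto
  next
    case False
    then show ?thesis using mn by auto
  qed
next
  fix h :: real
  assume "\<exists>p q :: int. coprime p q \<and> q \<noteq> 0 \<and>
     (odd q \<and> of_int m / (sqrt 2 * of_int n) = sqrt 2 * of_int p / of_int q \<and> h = (of_int q)\<^sup>2 \<or>
      odd p \<and> of_int m / (sqrt 2 * of_int n) = of_int p / (sqrt 2 * of_int q) \<and> h = 2 * (of_int q)\<^sup>2)"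
  then obtain p q :: int where pq: "coprime p q" "q \<noteq> 0"
    and "odd q \<and> of_int m / (sqrt 2 * of_int n) = sqrt 2 * of_int p / of_int q \<and> h = (of_int q)\<^sup>2 \<or>
      odd p \<and> of_int m / (sqrt 2 * of_int n) = of_int p / (sqrt 2 * of_int q) \<and> h = 2 * (of_int q)\<^sup>2"
    by blast
  then consider
      "odd q" "of_int m / (sqrt 2 * of_int n) = sqrt 2 * of_int p / of_int q" "h = (of_int q)\<^sup>2"
    | "odd p" "of_int m / (sqrt 2 * of_int n) = of_int p / (sqrt 2 * of_int q)" "h = 2 * (of_int q)\<^sup>2"
    by blast
  then show "h = (if even m then 1 else 2) * (of_int n)\<^sup>2"
  proof cases
    case 1
    \<comment> \<open>Since \<open>q\<close> is odd, 2 p / q is itself reduced and can be compared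
      with m / n.\<close>
    have "coprime (2 * p) q" using pq 1 by auto
    moreover have "(of_int m / of_int n :: real) = of_int (2 * p) / of_int q"
      using 1(2) mn pq by (simp add: field_simps)
    ultimately have "\<bar>m\<bar> = \<bar>2 * p\<bar>" "\<bar>n\<bar> = \<bar>q\<bar>"
      using coprime_fraction_unique[OF mn(1) _ mn(2) pq(2)] by blast+
    moreover from this have "even m" by presburger
    moreover have "(real_of_int n)\<^sup>2 = (of_int q)\<^sup>2"
      using \<open>\<bar>n\<bar> = \<bar>q\<bar>\<close> by (metis of_int_abs power2_abs)
    ultimately show ?thesis using 1 by simp
  next
    case 2
    have "(of_int m / of_int n :: real) = of_int p / of_int q"
      using 2(2) mn pq by (simp add: field_simps)
    then have "\<bar>m\<bar> = \<bar>p\<bar>" "\<bar>n\<bar> = \<bar>q\<bar>"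
      using coprime_fraction_unique[OF mn(1) pq(1) mn(2) pq(2)] by blast+
    moreover from this have "odd m" using 2(1) by presburger
    moreover have "(real_of_int n)\<^sup>2 = (of_int q)\<^sup>2"
      using \<open>\<bar>n\<bar> = \<bar>q\<bar>\<close> by (metis of_int_abs power2_abs)
    ultimately show ?thesis using 2 by simp
  qed
qed

section \<open>Lower bounds and finiteness for the heights on the line\<close>

lemma int_square_ge_1: "q \<noteq> 0 \<Longrightarrow> (1::real) \<le> (of_int q)\<^sup>2" for q :: int
  using of_int_le_iff[of 1 "q\<^sup>2", where 'a = real] by (simp add: int_one_le_iff_zero_less)

lemma height_Q_ge_1: "z \<in> \<rat> \<Longrightarrow> 1 \<le> height_Q z"
  by (erule Rats_cases') (simp add: height_Q_eq int_square_ge_1)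

text \<open>For a reduced fraction p / q with q \<ge> 1, the height bound gives
  \<open>q \<le> q\<^sup>2 \<le> B\<close>, and then |p| \<le> B q \<le> B B. Numerator and
  denominator thus lie in one box of side governed by \<open>N\<close>.\<close>

lemma finite_height_Q_le: "finite {z \<in> \<rat>. height_Q z \<le> B \<and> \<bar>z\<bar> \<le> B}"
proof (rule finite_subset)
  define N where "N = \<lfloor>B * B + B\<rfloor>"
  show "{z \<in> \<rat>. height_Q z \<le> B \<and> \<bar>z\<bar> \<le> B}
      \<subseteq> (\<lambda>(p, q). of_int p / of_int q) ` ({-N..N} \<times> {-N..N})"
  proof safe
    fix z :: real assume "z \<in> \<rat>" and le: "height_Q z \<le> B" "\<bar>z\<bar> \<le> B"
    then obtain p q where q: "q > 0" and pq: "coprime p q" and z: "z = of_int p / of_int q"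
      by (auto elim: Rats_cases')
    have q2: "(real_of_int q)\<^sup>2 \<le> B" using le(1) pq q by (simp add: z height_Q_eq)
    have "1 \<le> real_of_int q" using q by simp
    then have "real_of_int q \<le> (real_of_int q)\<^sup>2" by (simp add: power2_eq_square)
    then have qB: "real_of_int q \<le> B" using q2 by linarith
    have "\<bar>real_of_int p\<bar> \<le> B * real_of_int q" using le(2) q by (simp add: z field_simps)
    also have "\<dots> \<le> B * B" using qB \<open>1 \<le> real_of_int q\<close> by (intro mult_left_mono) auto
    finally have pB: "\<bar>real_of_int p\<bar> \<le> B * B" .
    have "0 \<le> B * B" by simp
    have "\<bar>p\<bar> \<le> N" "\<bar>q\<bar> \<le> N" unfolding N_def le_floor_iff of_int_abs
      using pB qB \<open>1 \<le> real_of_int q\<close> \<open>0 \<le> B * B\<close> by linarith+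
    then show "z \<in> (\<lambda>(p, q). of_int p / of_int q) ` ({-N..N} \<times> {-N..N})"
      unfolding z by (intro image_eqI[of _ _ "(p, q)"]) auto
  qed
qed simp

text \<open>Membership becomes rationality of a rescaled number because
  \<open>sqrt 2 * sqrt 2\<close> is rational; reduced fractions are then available for
  \<open>sqrt 2 * r\<close>.\<close>

lemma sqrt2_Q_iff: "r \<in> sqrt2_Q \<longleftrightarrow> sqrt 2 * r \<in> \<rat>"
proof
  assume "r \<in> sqrt2_Q"
  then show "sqrt 2 * r \<in> \<rat>" by (auto simp: sqrt2_Q_def mult.assoc[symmetric])
next
  assume "sqrt 2 * r \<in> \<rat>"
  then have "sqrt 2 * r / 2 \<in> \<rat>" by simp
  moreover have "r = sqrt 2 * (sqrt 2 * r / 2)" by simp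
  ultimately show "r \<in> sqrt2_Q" unfolding sqrt2_Q_def by blast
qed

lemma sqrt2_Q_cases:
  assumes "r \<in> sqrt2_Q"
  obtains m n :: int where "n > 0" "coprime m n" "sqrt 2 * r = of_int m / of_int n"
    "height_sqrt2_Q r = (if even m then 1 else 2) * (of_int n)\<^sup>2"
proof -
  obtain m n where mn: "n > 0" "coprime m n" "sqrt 2 * r = of_int m / of_int n"
    using assms by (auto simp: sqrt2_Q_iff elim: Rats_cases')
  then have "r = of_int m / (sqrt 2 * of_int n)" by (simp add: field_simps)
  with mn show ?thesis using that height_sqrt2_Q_eq by simp
qed

lemma height_sqrt2_Q_ge_1: "r \<in> sqrt2_Q \<Longrightarrow> 1 \<le> height_sqrt2_Q r"
proof (erule sqrt2_Q_cases)
  fix m n :: int assume "n > 0" "height_sqrt2_Q r = (if even m then 1 else 2) * (of_int n)\<^sup>2"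
  moreover from this have "(of_int n)\<^sup>2 \<le> height_sqrt2_Q r" by simp
  moreover have "(1::real) \<le> (of_int n)\<^sup>2" using \<open>n > 0\<close> by (intro int_square_ge_1) simp
  ultimately show "1 \<le> height_sqrt2_Q r" by linarith
qed

text \<open>Rescaling by \<open>sqrt 2\<close> does not increase the height, since the reduced
  denominator n of \<open>sqrt 2 * r\<close> satisfies
  \<open>n\<^sup>2 \<le> height_sqrt2_Q r\<close>, and it at most doubles the absolute value.
  Finiteness is thus inherited from the rationals.\<close>

lemma finite_height_sqrt2_Q_le: "finite {r \<in> sqrt2_Q. height_sqrt2_Q r \<le> B \<and> \<bar>r\<bar> \<le> B}"
proof (rule finite_subset)
  show "{r \<in> sqrt2_Q. height_sqrt2_Q r \<le> B \<and> \<bar>r\<bar> \<le> B}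
      \<subseteq> (\<lambda>z. z / sqrt 2) ` {z \<in> \<rat>. height_Q z \<le> 2 * B \<and> \<bar>z\<bar> \<le> 2 * B}"
  proof safe
    fix r assume r: "r \<in> sqrt2_Q" and le: "height_sqrt2_Q r \<le> B" "\<bar>r\<bar> \<le> B"
    obtain m n :: int where mn: "n > 0" "coprime m n" "sqrt 2 * r = of_int m / of_int n"
      "height_sqrt2_Q r = (if even m then 1 else 2) * (of_int n)\<^sup>2"
      using sqrt2_Q_cases[OF r] .
    have "height_Q (sqrt 2 * r) = (of_int n)\<^sup>2" using mn by (simp add: height_Q_eq)
    also have "\<dots> \<le> height_sqrt2_Q r" using mn(4) by simp
    finally have "height_Q (sqrt 2 * r) \<le> 2 * B" using le by linarith
    moreover have "\<bar>sqrt 2 * r\<bar> \<le> 2 * B"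
      unfolding abs_mult using le(2) by (intro mult_mono) (auto simp: real_le_lsqrt)
    moreover have "r = sqrt 2 * r / sqrt 2" by simp
    ultimately show "r \<in> (\<lambda>z. z / sqrt 2) ` {z \<in> \<rat>. height_Q z \<le> 2 * B \<and> \<bar>z\<bar> \<le> 2 * B}"
      using r unfolding sqrt2_Q_iff by blast
  qed
qed (intro finite_imageI finite_height_Q_le)

subsection \<open>Stereographic projection of the unit circle\<close>

lemma one_add_square_pos: "1 + t\<^sup>2 > 0" for t :: real
  by (simp add: add_pos_nonneg)

text \<open>The second intersection of the unit circle with the line through (0, 1) and (t,
  0).\<close>

definition stereo :: "real \<Rightarrow> real^2" where
  "stereo t = vector [2 * t / (1 + t\<^sup>2), (t\<^sup>2 - 1) / (1 + t\<^sup>2)]"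

abbreviation north_pole :: "real^2" where
  "north_pole \<equiv> vector [0, 1]"

lemma dist_stereo: "dist (stereo s) (stereo t) = 2 * \<bar>s - t\<bar> / (sqrt (1 + s\<^sup>2) * sqrt (1 + t\<^sup>2))"
proof -
  have "(2 * s / (1 + s\<^sup>2) - 2 * t / (1 + t\<^sup>2))\<^sup>2 + ((s\<^sup>2 - 1) / (1 + s\<^sup>2) - (t\<^sup>2 - 1) / (1 + t\<^sup>2))\<^sup>2
      = (2 * \<bar>s - t\<bar>)\<^sup>2 / ((1 + s\<^sup>2) * (1 + t\<^sup>2))"
    using one_add_square_pos[of s] one_add_square_pos[of t]
    by (simp add: divide_simps) (simp add: power2_eq_square algebra_simps)
  then show ?thesis
    by (simp add: dist_vec2 stereo_def real_sqrt_divide real_sqrt_mult)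
qed

lemma stereo_inverse: "stereo t $ 1 / (1 - stereo t $ 2) = t"
proof -
  have "1 - stereo t $ 2 = 2 / (1 + t\<^sup>2)"
    using one_add_square_pos[of t] by (simp add: stereo_def field_simps)
  then show ?thesis
    using one_add_square_pos[of t] by (simp add: stereo_def)
qed

lemma stereo_bij: "bij_betw stereo UNIV (circle_I - {north_pole})"
proof (rule bij_betw_byWitness[where f' = "\<lambda>x. x$1 / (1 - x$2)"])
  show "\<forall>t\<in>UNIV. stereo t $ 1 / (1 - stereo t $ 2) = t"
    by (simp add: stereo_inverse)
  show "\<forall>x\<in>circle_I - {north_pole}. stereo (x$1 / (1 - x$2)) = x"
  proof
    fix x :: "real^2" assume "x \<in> circle_I - {north_pole}"
    then have x: "(x$1)\<^sup>2 + (x$2)\<^sup>2 = 1" "x \<noteq> north_pole" by (auto simp: circle_I_def)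
    have ne: "x$2 \<noteq> 1" using x by (auto simp: vec_eq_iff forall_2)
    define t where "t = x$1 / (1 - x$2)"
    \<comment> \<open>The circle equation factors \<open>(x$1)\<^sup>2\<close>, so the square of
      \<open>t\<close> depends on \<open>x$2\<close> alone and one factor \<open>1 - x$2\<close>
      cancels.\<close>
    have "t\<^sup>2 = (1 + x$2) / (1 - x$2)"
    proof -
      have "(x$1)\<^sup>2 = (1 + x$2) * (1 - x$2)" using x(1) by (simp add: power2_eq_square algebra_simps)
      then show ?thesis using ne by (simp add: t_def power_divide power2_eq_square[of "1 - x$2"])
    qed
    then have "1 + t\<^sup>2 = 2 / (1 - x$2)" "t\<^sup>2 - 1 = 2 * x$2 / (1 - x$2)"
      using ne by (simp_all add: field_simps)
    then have "stereo t = x"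
      using ne by (simp add: stereo_def vec_eq_iff forall_2) (simp add: t_def)
    then show "stereo (x$1 / (1 - x$2)) = x" by (simp add: t_def)
  qed
  show "stereo ` UNIV \<subseteq> circle_I - {north_pole}"
  proof
    fix x assume "x \<in> stereo ` UNIV"
    then obtain t where x: "x = stereo t" by blast
    have "(2 * t)\<^sup>2 + (t\<^sup>2 - 1)\<^sup>2 = (1 + t\<^sup>2)\<^sup>2" by (simp add: power2_eq_square algebra_simps)
    then have "x \<in> circle_I"
      using one_add_square_pos[of t]
      by (simp add: circle_I_def x stereo_def power_divide flip: add_divide_distrib)
    moreover have "stereo t $ 2 \<noteq> 1"
      using one_add_square_pos[of t] by (simp add: stereo_def)
    then have "x \<noteq> north_pole" by (auto simp: x)
    ultimately show "x \<in> circle_I - {north_pole}" by blast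
  qed
  show "(\<lambda>x. x$1 / (1 - x$2)) ` (circle_I - {north_pole}) \<subseteq> UNIV" by simp
qed

lemma stereo_rational_iff: "stereo t \<in> rational_points \<longleftrightarrow> t \<in> \<rat>"
proof
  assume "stereo t \<in> rational_points"
  then have "stereo t $ 1 / (1 - stereo t $ 2) \<in> \<rat>" by (simp add: rational_points_def)
  then show "t \<in> \<rat>" by (simp only: stereo_inverse)
qed (simp add: rational_points_def stereo_def forall_2)

text \<open>For odd \<open>m\<close> and \<open>n\<close> the classical triple \<open>(2 m n, m\<^sup>2 - n\<^sup>2, m\<^sup>2 + n\<^sup>2)\<close> is twice a
  primitive one. The parity of \<open>a + b\<close> makes the vector \<open>(a - b, a + b)\<close> primitive as well.\<close>

lemma stereo_pythagorean_triple:
  fixes m n :: int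
  assumes mn: "coprime m n" "n > 0"
  obtains a b c :: int where "coprime a b" "odd (a + b)" "c > 0"
    "stereo (of_int m / of_int n) = (\<chi> i. of_int ((vector [a, b] :: int^2) $ i) / of_int c)"
    "real_of_int c = (of_int m ^ 2 + of_int n ^ 2) / (if odd m \<and> odd n then 2 else 1)"
proof -
  define t where "t = real_of_int m / of_int n"
  have n0: "real_of_int n \<noteq> 0" using mn by simp
  have pos: "(real_of_int m)\<^sup>2 + (of_int n)\<^sup>2 > 0" using n0 by (simp add: add_nonneg_pos)
  have 1: "2 * t / (1 + t\<^sup>2) = of_int (2 * m * n) / of_int (m\<^sup>2 + n\<^sup>2)"
    "(t\<^sup>2 - 1) / (1 + t\<^sup>2) = of_int (m\<^sup>2 - n\<^sup>2) / of_int (m\<^sup>2 + n\<^sup>2)"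
    using n0 pos by (simp_all add: t_def power2_eq_square divide_simps)
  \<comment> \<open>Both factors m + n and m - n are coprime to m and to n; only the factor 2 in 2 m
    n remains to be treated, by parity.\<close>
  have cop: "coprime (m\<^sup>2 - n\<^sup>2) (m * n)"
  proof -
    have "m\<^sup>2 - n\<^sup>2 = (m + n) * (m - n)" by (simp add: power2_eq_square algebra_simps)
    moreover have "coprime (m + n) n" "coprime (m - n) n" "coprime (m + n) m" "coprime (m - n) m"
      using mn(1) by (metis add.commute coprime_iff_gcd_eq_1 gcd.commute gcd_add1 gcd_diff1 gcd_diff2)+
    ultimately show ?thesis by simp
  qed
  have pos': "m\<^sup>2 + n\<^sup>2 > 0" using mn(2) by (simp add: add_nonneg_pos)
  show thesis
  proof (cases "odd m \<and> odd n")
    case False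
    have "odd m \<or> odd n" using mn(1) by auto
    then have "odd (m\<^sup>2 - n\<^sup>2)" using False by auto
    then have "coprime (2 * m * n) (m\<^sup>2 - n\<^sup>2)"
      using cop by (simp add: coprime_commute mult.assoc)
    then show thesis
      using False pos' \<open>odd (m\<^sup>2 - n\<^sup>2)\<close> 1
      by (intro that[of "2 * m * n" "m\<^sup>2 - n\<^sup>2" "m\<^sup>2 + n\<^sup>2"])
        (auto simp: stereo_def vec_eq_iff forall_2 simp flip: t_def)
  next
    case True
    \<comment> \<open>Explicit odd numbers exhibit the halves: \<open>b\<close> is even while m n is
      odd, so the halved pair again has odd sum and the factor 2 is gone.\<close>
    then obtain k l where kl: "m = 2 * k + 1" "n = 2 * l + 1" by (auto elim!: oddE)
    define b where "b = 2 * (k\<^sup>2 + k - l\<^sup>2 - l)"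
    define c where "c = 2 * (k\<^sup>2 + k + l\<^sup>2 + l) + 1"
    have b: "m\<^sup>2 - n\<^sup>2 = 2 * b" and c: "m\<^sup>2 + n\<^sup>2 = 2 * c"
      by (simp_all add: kl b_def c_def power2_eq_square algebra_simps)
    have "coprime (m * n) b" using cop by (simp add: b coprime_commute)
    moreover have "odd (m * n + b)" using True by (simp add: b_def)
    moreover have "c > 0" using pos' c by linarith
    moreover have "stereo t = (\<chi> i. of_int ((vector [m * n, b] :: int^2) $ i) / of_int c)"
      using 1 unfolding b c by (simp add: stereo_def vec_eq_iff forall_2)
    moreover have "real_of_int (m\<^sup>2 + n\<^sup>2) = 2 * of_int c" by (simp add: c del: of_int_add of_int_power)
    ultimately show thesis
      using True by (intro that[of "m * n" b c]) (auto simp: t_def)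
  qed
qed

text \<open>Multiplication by \<open>1 + \<i>\<close> on the complex plane.\<close>

definition rot :: "real^2 \<Rightarrow> real^2" where
  "rot x = vector [x$1 - x$2, x$1 + x$2]"

text \<open>The shift by \<open>1\<close> matches the two parity cases of both heights: for \<open>sqrt 2 * r = m / n\<close> the
  pair \<open>(m + n, n)\<close> consists of odd numbers iff \<open>m\<close> is even.\<close>

lemma stereo_sqrt2_height:
  assumes "r \<in> sqrt2_Q"
  defines "h \<equiv> (1 + (sqrt 2 * r + 1)\<^sup>2) * height_sqrt2_Q r / 2"
  shows "height_vec (stereo (sqrt 2 * r + 1)) = h"
    and "height_vec (rot (stereo (sqrt 2 * r + 1))) = h"
proof -
  obtain m n :: int where mn: "n > 0" "coprime m n" "sqrt 2 * r = of_int m / of_int n"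
    and H: "height_sqrt2_Q r = (if even m then 1 else 2) * (of_int n)\<^sup>2"
    using sqrt2_Q_cases[OF assms(1)] .
  have t: "sqrt 2 * r + 1 = of_int (m + n) / of_int n" using mn by (simp add: field_simps)
  have cop: "coprime (m + n) n" using mn(2) by (simp add: coprime_iff_gcd_eq_1)
  obtain a b c :: int where abc: "coprime a b" "odd (a + b)" "c > 0"
    and st: "stereo (of_int (m + n) / of_int n) = (\<chi> i. of_int ((vector [a, b] :: int^2) $ i) / of_int c)"
    and c: "real_of_int c = (of_int (m + n) ^ 2 + of_int n ^ 2) / (if odd (m + n) \<and> odd n then 2 else 1)"
    using stereo_pythagorean_triple[OF cop mn(1)] .
  \<comment> \<open>For even \<open>m\<close> the triple is halved and the height of
    \<open>r\<close> is \<open>n\<^sup>2\<close>; for odd \<open>m\<close> there is no halving and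
    the height is \<open>2 * n\<^sup>2\<close>. Both cases give the same formula \<open>h\<close>
    for the denominator.\<close>
  have "odd (m + n) \<and> odd n \<longleftrightarrow> even m" using mn(2) by auto
  then have ch: "real_of_int c = h"
    unfolding c h_def H t using mn(1) by (simp add: power_divide field_simps)
  show "height_vec (stereo (sqrt 2 * r + 1)) = h"
    unfolding t st using abc by (simp only: height_vec_eq primitive_vec2 ch[symmetric])
  \<comment> \<open>A common divisor divides 2 a and 2 b; it is odd because a + b is odd, so it
    divides both \<open>a\<close> and \<open>b\<close>.\<close>
  have "coprime (a - b) (a + b)"
  proof (rule coprimeI)
    fix d assume d: "d dvd a - b" "d dvd a + b"
    then have "d dvd 2 * a" "d dvd 2 * b" using dvd_add[OF d] dvd_diff[OF d(2,1)] by simp_all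
    moreover have "odd d" using d(2) abc(2) dvd_trans by blast
    ultimately show "is_unit d" using abc(1) by (auto simp: coprime_dvd_mult_right_iff dest: coprime_common_divisor)
  qed
  moreover have "rot (stereo (sqrt 2 * r + 1)) = (\<chi> i. of_int ((vector [a - b, a + b] :: int^2) $ i) / of_int c)"
    unfolding t st by (simp add: rot_def vec_eq_iff forall_2 diff_divide_distrib add_divide_distrib)
  ultimately show "height_vec (rot (stereo (sqrt 2 * r + 1))) = h"
    using abc by (simp add: height_vec_eq primitive_vec2 flip: ch)
qed


text \<open>The factor is the absolute value of 1 + i. As heights are unchanged under
  \<open>rot\<close>, it accounts for the passage from the constant \<open>sqrt 2\<close> on the
  first circle to 2 on the second.\<close>

lemma dist_rot: "dist (rot x) (rot y) = sqrt 2 * dist x y"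
proof -
  have "(x$1 - x$2 - (y$1 - y$2))\<^sup>2 + (x$1 + x$2 - (y$1 + y$2))\<^sup>2
      = 2 * ((x$1 - y$1)\<^sup>2 + (x$2 - y$2)\<^sup>2)"
    by (simp add: power2_eq_square algebra_simps)
  then show ?thesis by (simp add: dist_vec2 rot_def flip: real_sqrt_mult)
qed

lemma rot_rational_iff: "rot x \<in> rational_points \<longleftrightarrow> x \<in> rational_points"
proof
  assume "rot x \<in> rational_points"
  then have "x$1 - x$2 \<in> \<rat>" "x$1 + x$2 \<in> \<rat>"
    by (auto simp: rational_points_def rot_def forall_2)
  then have "(x$1 - x$2 + (x$1 + x$2)) / 2 \<in> \<rat>" "(x$1 + x$2 - (x$1 - x$2)) / 2 \<in> \<rat>"
    by (metis Rats_add Rats_diff Rats_divide Rats_number_of)+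
  then show "x \<in> rational_points" by (simp add: rational_points_def forall_2)
qed (simp add: rational_points_def rot_def forall_2)

lemma rot_bij: "bij_betw rot (circle_I - {n}) (circle_II - {rot n})"
\<comment> \<open>The witness is division by 1 + i.\<close>
proof (rule bij_betw_byWitness[where f' = "\<lambda>y. vector [(y$1 + y$2) / 2, (y$2 - y$1) / 2]"])
  have sq: "(a - b)\<^sup>2 + (a + b)\<^sup>2 = 2 * (a\<^sup>2 + b\<^sup>2)"
    "((a + b) / 2)\<^sup>2 + ((b - a) / 2)\<^sup>2 = (a\<^sup>2 + b\<^sup>2) / 2" for a b :: real
    by (simp_all add: power2_eq_square field_simps)
  show "\<forall>x\<in>circle_I - {n}. vector [(rot x $ 1 + rot x $ 2) / 2, (rot x $ 2 - rot x $ 1) / 2] = x"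
    by (simp add: rot_def vec_eq_iff forall_2)
  show "\<forall>y\<in>circle_II - {rot n}. rot (vector [(y$1 + y$2) / 2, (y$2 - y$1) / 2]) = y"
    by (simp add: rot_def vec_eq_iff forall_2 field_simps)
  show "rot ` (circle_I - {n}) \<subseteq> circle_II - {rot n}"
  proof (rule image_subsetI)
    fix x assume x: "x \<in> circle_I - {n}"
    have "rot x \<noteq> rot n" using x dist_rot[of x n] by auto
    with x show "rot x \<in> circle_II - {rot n}" by (simp add: circle_I_def circle_II_def rot_def sq)
  qed
  show "(\<lambda>y. vector [(y$1 + y$2) / 2, (y$2 - y$1) / 2]) ` (circle_II - {rot n}) \<subseteq> circle_I - {n}"
  proof (rule image_subsetI)
    fix y :: "real^2" assume y: "y \<in> circle_II - {rot n}"
    define x :: "real^2" where "x = vector [(y$1 + y$2) / 2, (y$2 - y$1) / 2]"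
    have "rot x = y" by (simp add: x_def rot_def vec_eq_iff forall_2 field_simps)
    then have "x \<noteq> n" using y by auto
    moreover have "x \<in> circle_I" using y by (simp add: x_def circle_I_def circle_II_def sq)
    ultimately show "vector [(y$1 + y$2) / 2, (y$2 - y$1) / 2] \<in> circle_I - {n}"
      by (simp add: x_def)
  qed
qed

subsection \<open>Stereographic projection of the third circle\<close>

text \<open>The bound is written as a square so that taking roots yields the lower bound 1/2 for the
  weight on the third circle.\<close>

lemma norm_form_ge: "t\<^sup>2 + t + 1 \<ge> (1 / 2)\<^sup>2" for t :: real
proof -
  have "t\<^sup>2 + t + 1 = (t + 1 / 2)\<^sup>2 + 3 / 4" by (simp add: power2_eq_square algebra_simps)
  then show ?thesis by (simp add: power2_eq_square)
qed

lemma norm_form_pos: "t\<^sup>2 + t + 1 > 0" for t :: real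
  using norm_form_ge[of t] by (simp add: power2_eq_square)

text \<open>The second intersection of the circle with the line through (0, 1, 0) and (-t, 0, t +
  1), a line inside the plane where the coordinates sum to 1.\<close>

definition stereo_III :: "real \<Rightarrow> real^3" where
  "stereo_III t =
     vector [- t / (t\<^sup>2 + t + 1), (t\<^sup>2 + t) / (t\<^sup>2 + t + 1), (t + 1) / (t\<^sup>2 + t + 1)]"

abbreviation pole_III :: "real^3" where
  "pole_III \<equiv> vector [0, 1, 0]"

lemma dist_stereo_III: "dist (stereo_III s) (stereo_III t) =
  sqrt 2 * \<bar>s - t\<bar> / (sqrt (s\<^sup>2 + s + 1) * sqrt (t\<^sup>2 + t + 1))"
proof -
  have "(- s / (s\<^sup>2 + s + 1) - - t / (t\<^sup>2 + t + 1))\<^sup>2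
      + ((s\<^sup>2 + s) / (s\<^sup>2 + s + 1) - (t\<^sup>2 + t) / (t\<^sup>2 + t + 1))\<^sup>2
      + ((s + 1) / (s\<^sup>2 + s + 1) - (t + 1) / (t\<^sup>2 + t + 1))\<^sup>2
      = 2 * (\<bar>s - t\<bar>)\<^sup>2 / ((s\<^sup>2 + s + 1) * (t\<^sup>2 + t + 1))"
    using norm_form_pos[of s] norm_form_pos[of t]
    by (simp add: divide_simps) (simp add: power2_eq_square algebra_simps)
  then show ?thesis
    by (simp add: dist_vec3 stereo_III_def real_sqrt_divide real_sqrt_mult)
qed

lemma stereo_III_inverse: "- stereo_III t $ 1 / (1 - stereo_III t $ 2) = t"
proof -
  have "1 - stereo_III t $ 2 = 1 / (t\<^sup>2 + t + 1)"
    using norm_form_pos[of t] by (simp add: stereo_III_def field_simps)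
  then show ?thesis
    using norm_form_pos[of t] by (simp add: stereo_III_def)
qed

lemma stereo_III_bij: "bij_betw stereo_III UNIV (circle_III - {pole_III})"
proof (rule bij_betw_byWitness[where f' = "\<lambda>x. - x$1 / (1 - x$2)"])
  show "\<forall>t\<in>UNIV. - stereo_III t $ 1 / (1 - stereo_III t $ 2) = t"
    using stereo_III_inverse by blast
  show "\<forall>x\<in>circle_III - {pole_III}. stereo_III (- x$1 / (1 - x$2)) = x"
  proof
    fix x :: "real^3" assume "x \<in> circle_III - {pole_III}"
    then have x3: "x$3 = 1 - x$1 - x$2" and sq: "(x$1)\<^sup>2 + (x$2)\<^sup>2 + (x$3)\<^sup>2 = 1" and "x \<noteq> pole_III"
      by (auto simp: circle_III_def)
    \<comment> \<open>Eliminating \<open>x$3\<close> makes the sphere equation factor. This shows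
      that \<open>x$2 = 1\<close> holds only at the pole, and it makes one factor
      \<open>1 - x$2\<close> cancel in the square of \<open>t\<close>.\<close>
    have q: "(x$1)\<^sup>2 = (1 - x$2) * (x$1 + x$2)"
      using sq unfolding x3 by (simp add: power2_eq_square algebra_simps)
    have ne: "x$2 \<noteq> 1"
    proof
      assume "x$2 = 1"
      with q have "x$1 = 0" by simp
      with \<open>x$2 = 1\<close> x3 \<open>x \<noteq> pole_III\<close> show False by (simp add: vec_eq_iff forall_3)
    qed
    define t where "t = - x$1 / (1 - x$2)"
    have "t\<^sup>2 = (x$1 + x$2) / (1 - x$2)"
      using ne by (simp add: t_def power_divide q power2_eq_square[of "1 - x$2"])
    then have "t\<^sup>2 + t = (x$1 + x$2) / (1 - x$2) + (- x$1) / (1 - x$2)"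
      by (simp only:) (simp add: t_def)
    also have "\<dots> = x$2 / (1 - x$2)" by (simp flip: add_divide_distrib diff_divide_distrib)
    finally have tt: "t\<^sup>2 + t = x$2 / (1 - x$2)" .
    have "t\<^sup>2 + t + 1 = 1 / (1 - x$2)" unfolding tt using ne by (simp add: field_simps)
    moreover have "t + 1 = x$3 / (1 - x$2)" using ne by (simp add: t_def x3 field_simps)
    moreover note tt
    ultimately have "stereo_III t = x"
      using ne by (simp add: stereo_III_def vec_eq_iff forall_3) (simp add: t_def)
    then show "stereo_III (- x$1 / (1 - x$2)) = x" by (simp add: t_def)
  qed
  show "stereo_III ` UNIV \<subseteq> circle_III - {pole_III}"
  proof
    fix x assume "x \<in> stereo_III ` UNIV"
    then obtain t where x: "x = stereo_III t" by blast
    have "(- t)\<^sup>2 + (t\<^sup>2 + t)\<^sup>2 + (t + 1)\<^sup>2 = (t\<^sup>2 + t + 1)\<^sup>2"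
      by (simp add: power2_eq_square algebra_simps)
    then have "(- t / (t\<^sup>2 + t + 1))\<^sup>2 + ((t\<^sup>2 + t) / (t\<^sup>2 + t + 1))\<^sup>2
        + ((t + 1) / (t\<^sup>2 + t + 1))\<^sup>2 = 1"
      using norm_form_pos[of t] by (simp add: power_divide flip: add_divide_distrib)
    moreover have "- t / (t\<^sup>2 + t + 1) + (t\<^sup>2 + t) / (t\<^sup>2 + t + 1) + (t + 1) / (t\<^sup>2 + t + 1) = 1"
      using norm_form_pos[of t] unfolding add_divide_distrib[symmetric] by simp
    ultimately have "x \<in> circle_III"
      by (simp add: circle_III_def x stereo_III_def)
    moreover have "stereo_III t $ 2 \<noteq> 1"
      using norm_form_pos[of t] by (simp add: stereo_III_def)
    then have "x \<noteq> pole_III" by (auto simp: x)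
    ultimately show "x \<in> circle_III - {pole_III}" by blast
  qed
qed simp

lemma stereo_III_rational_iff: "stereo_III t \<in> rational_points \<longleftrightarrow> t \<in> \<rat>"
proof
  assume "stereo_III t \<in> rational_points"
  then have "- stereo_III t $ 1 / (1 - stereo_III t $ 2) \<in> \<rat>" by (simp add: rational_points_def)
  then show "t \<in> \<rat>" by (simp only: stereo_III_inverse)
qed (simp add: rational_points_def stereo_III_def forall_3)

text \<open>For t = a / b the numerators are -a b, a (a + b), b (a + b) over
  \<open>a\<^sup>2 + a * b + b\<^sup>2\<close>. The last two have gcd |a + b|, which is coprime to a
  b, so the vector is primitive in every parity case.\<close>

lemma stereo_III_height:
  assumes "t \<in> \<rat>"
  shows "height_vec (stereo_III t) = (t\<^sup>2 + t + 1) * height_Q t"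
proof -
  obtain a b where ab: "b > 0" "coprime a b" and t: "t = of_int a / of_int b"
    using assms by (auto elim: Rats_cases')
  define N where "N = a\<^sup>2 + a * b + b\<^sup>2"
  have tN: "t\<^sup>2 + t + 1 = of_int N / (of_int b)\<^sup>2"
    using ab(1) by (simp add: t N_def power2_eq_square field_simps)
  then have N: "of_int N > (0::real)" using norm_form_pos[of t] ab(1) by (simp add: zero_less_divide_iff)
  have eq: "stereo_III t =
      (\<chi> i. of_int ((vector [- (a * b), a * (a + b), b * (a + b)] :: int^3) $ i) / of_int N)"
    unfolding stereo_III_def tN
    using ab(1) N
    by (simp add: vec_eq_iff forall_3 t power2_eq_square divide_simps) (simp add: algebra_simps)
  have "coprime a (a + b)" "coprime b (a + b)"
    using ab(2) by (metis add.commute coprime_iff_gcd_eq_1 gcd.commute gcd_add1)+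
  then have "coprime (a * b) (a + b)" by simp
  then have "gcd (a * b) (a + b) = 1" by (simp only: coprime_iff_gcd_eq_1)
  moreover have "gcd (a * (a + b)) (b * (a + b)) = \<bar>a + b\<bar>"
    using ab(2) gcd_mult_right[of a "a + b" b] by (simp add: gcd.commute[of b a])
  ultimately have "primitive_vec (vector [- (a * b), a * (a + b), b * (a + b)] :: int^3)"
    by (simp add: primitive_vec3)
  then have "height_vec (stereo_III t) = of_int N"
    unfolding eq using N by (subst height_vec_eq) auto
  also have "\<dots> = (t\<^sup>2 + t + 1) * height_Q t"
    using ab by (simp add: tN) (simp add: t height_Q_eq)
  finally show ?thesis .
qed


section \<open>Assembly of the three parametrizations\<close>

theorem theorem1p1:
  shows "(\<exists>n \<in> circle_I \<inter> rational_points. \<exists>\<Phi> :: real \<Rightarrow> real^2.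
            continuous_on UNIV \<Phi> \<and> bij_betw \<Phi> UNIV (circle_I - {n}) \<and>
            \<Phi> ` sqrt2_Q = (circle_I \<inter> rational_points) - {n} \<and>
            (\<forall>\<xi>. \<xi> \<notin> sqrt2_Q \<longrightarrow>
               lagrange_number sqrt2_Q height_sqrt2_Q \<xi> =
               ennreal (sqrt 2) * lagrange_number (circle_I \<inter> rational_points) height_vec (\<Phi> \<xi>)))
       \<and> (\<exists>n \<in> circle_II \<inter> rational_points. \<exists>\<Phi> :: real \<Rightarrow> real^2.
            continuous_on UNIV \<Phi> \<and> bij_betw \<Phi> UNIV (circle_II - {n}) \<and>
            \<Phi> ` sqrt2_Q = (circle_II \<inter> rational_points) - {n} \<and>
            (\<forall>\<xi>. \<xi> \<notin> sqrt2_Q \<longrightarrow>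
               lagrange_number sqrt2_Q height_sqrt2_Q \<xi> =
               2 * lagrange_number (circle_II \<inter> rational_points) height_vec (\<Phi> \<xi>)))
       \<and> (\<exists>n \<in> circle_III \<inter> rational_points. \<exists>\<Phi> :: real \<Rightarrow> real^3.
            continuous_on UNIV \<Phi> \<and> bij_betw \<Phi> UNIV (circle_III - {n}) \<and>
            \<Phi> ` \<rat> = (circle_III \<inter> rational_points) - {n} \<and>
            (\<forall>\<xi>. \<xi> \<notin> \<rat> \<longrightarrow>
               lagrange_number \<rat> height_Q \<xi> =
               ennreal (sqrt 2) * lagrange_number (circle_III \<inter> rational_points) height_vec (\<Phi> \<xi>)))"
    (is "?I \<and> ?II \<and> ?III")
proof (intro conjI)
  define \<Phi> where "\<Phi> = (\<lambda>r. stereo (sqrt 2 * r + 1))"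
  define g where "g r = sqrt (1 + (sqrt 2 * r + 1)\<^sup>2)" for r
  have g: "g r \<ge> 1" "(g r)\<^sup>2 = 1 + (sqrt 2 * r + 1)\<^sup>2" for r
    using one_add_square_pos[of "sqrt 2 * r + 1"] by (simp_all add: g_def)
  have contg: "continuous_on UNIV g" unfolding g_def by (intro continuous_intros)
  \<comment> \<open>The constant is 2 from \<open>stereo\<close> times \<open>sqrt 2\<close> from
    the affine change of parameter.\<close>
  have dist: "dist (\<Phi> s) (\<Phi> t) = 2 * sqrt 2 * \<bar>s - t\<bar> / (g s * g t)" for s t
  proof -
    have "sqrt 2 * s + 1 - (sqrt 2 * t + 1) = sqrt 2 * (s - t)" by (simp add: algebra_simps)
    then show ?thesis by (simp add: \<Phi>_def g_def dist_stereo abs_mult)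
  qed
  have dist': "dist (rot (\<Phi> s)) (rot (\<Phi> t)) = 4 * \<bar>s - t\<bar> / (g s * g t)" for s t
    by (simp add: dist_rot dist)
  have "bij_betw (\<lambda>r. sqrt 2 * r + 1) UNIV UNIV"
    by (rule bij_betw_byWitness[where f' = "\<lambda>t. (t - 1) / sqrt 2"]) auto
  from bij_betw_trans[OF this stereo_bij]
  have bij: "bij_betw \<Phi> UNIV (circle_I - {north_pole})" by (simp add: \<Phi>_def comp_def)
  from bij_betw_trans[OF this rot_bij]
  have bij': "bij_betw (\<lambda>r. rot (\<Phi> r)) UNIV (circle_II - {rot north_pole})" by (simp add: comp_def)
  have rat: "\<Phi> r \<in> rational_points \<longleftrightarrow> r \<in> sqrt2_Q" for r
    using Rats_add[of "sqrt 2 * r" 1] Rats_diff[of "sqrt 2 * r + 1" 1]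
    by (auto simp: \<Phi>_def stereo_rational_iff sqrt2_Q_iff)
  have rat': "rot (\<Phi> r) \<in> rational_points \<longleftrightarrow> r \<in> sqrt2_Q" for r
    by (simp add: rot_rational_iff rat)
  have north: "north_pole \<in> rational_points" by (simp add: rational_points_def forall_2)
  note img = image_eq_of_bij_betw[OF bij rat]
  note img' = image_eq_of_bij_betw[OF bij' rat']
  show ?I
  proof (rule bexI[of _ north_pole], rule exI[of _ \<Phi>], intro conjI allI impI)
    fix \<xi> assume "\<xi> \<notin> sqrt2_Q"
    \<comment> \<open>The division by 2 in \<open>stereo_sqrt2_height\<close> is \<kappa> = 1/2, and
      1/2 times \<open>2 * sqrt 2\<close> is \<open>sqrt 2\<close>.\<close>
    show "lagrange_number sqrt2_Q height_sqrt2_Q \<xi> =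
        ennreal (sqrt 2) * lagrange_number (circle_I \<inter> rational_points) height_vec (\<Phi> \<xi>)"
      using lagrange_number_transfer[where \<kappa> = "1 / 2", OF dist _ _ _ zero_less_one g(1) contg
          height_sqrt2_Q_ge_1 finite_height_sqrt2_Q_le img \<open>\<xi> \<notin> sqrt2_Q\<close>, where H' = height_vec]
      by (simp add: \<Phi>_def stereo_sqrt2_height g(2))
  next
    show "continuous_on UNIV \<Phi>" by (rule continuous_on_chordal[OF dist g(1)]) auto
  qed (use bij img north in \<open>auto simp: circle_I_def\<close>)
  show ?II
  proof (rule bexI[of _ "rot north_pole"], rule exI[of _ "\<lambda>r. rot (\<Phi> r)"], intro conjI allI impI)
    fix \<xi> assume "\<xi> \<notin> sqrt2_Q"
    \<comment> \<open>Same \<kappa> = 1/2, now with K = 4, so the constant is 2.\<close>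
    show "lagrange_number sqrt2_Q height_sqrt2_Q \<xi> =
        2 * lagrange_number (circle_II \<inter> rational_points) height_vec (rot (\<Phi> \<xi>))"
      using lagrange_number_transfer[where \<kappa> = "1 / 2", OF dist' _ _ _ zero_less_one g(1) contg
          height_sqrt2_Q_ge_1 finite_height_sqrt2_Q_le img' \<open>\<xi> \<notin> sqrt2_Q\<close>, where H' = height_vec]
      by (simp add: \<Phi>_def stereo_sqrt2_height g(2))
  next
    show "continuous_on UNIV (\<lambda>r. rot (\<Phi> r))" by (rule continuous_on_chordal[OF dist' g(1)]) auto
  next
    show "rot north_pole \<in> circle_II \<inter> rational_points"
      using north by (simp add: rot_rational_iff) (simp add: circle_II_def rot_def)
  qed (use bij' img' in auto)
next
  define g :: "real \<Rightarrow> real" where "g t = sqrt (t\<^sup>2 + t + 1)" for t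
  have g: "g t \<ge> 1 / 2" "(g t)\<^sup>2 = t\<^sup>2 + t + 1" for t
    using real_le_rsqrt[OF norm_form_ge[of t]] norm_form_pos[of t] unfolding g_def by simp_all
  have contg: "continuous_on UNIV g" unfolding g_def by (intro continuous_intros)
  note dist = dist_stereo_III[folded g_def]
  note img = image_eq_of_bij_betw[OF stereo_III_bij stereo_III_rational_iff]
  show ?III
  proof (rule bexI[of _ pole_III], rule exI[of _ stereo_III], intro conjI allI impI)
    fix \<xi> :: real assume "\<xi> \<notin> \<rat>"
    \<comment> \<open>Here \<kappa> = 1 and K = \<open>sqrt 2\<close>.\<close>
    show "lagrange_number \<rat> height_Q \<xi> =
        ennreal (sqrt 2) * lagrange_number (circle_III \<inter> rational_points) height_vec (stereo_III \<xi>)"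
      using lagrange_number_transfer[where \<kappa> = 1, OF dist _ _ _ _ g(1) contg
          height_Q_ge_1 finite_height_Q_le img \<open>\<xi> \<notin> \<rat>\<close>, where H' = height_vec]
      by (simp add: stereo_III_height g(2))
  next
    show "continuous_on UNIV stereo_III" by (rule continuous_on_chordal[OF dist g(1)]) auto
  qed (use stereo_III_bij img in \<open>auto simp: circle_III_def rational_points_def forall_3\<close>)
qed

end
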